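(* Let $m > d\geq 1$ be integers, let $F$ be a finite family of compact convex sets in $\mathbb{R}^m$, and let $Y$ be a locally finite $d$-dimensional simplicial complex. If every $d+1$ or fewer members of $F$ have nonempty intersection, then for every continuous map $f \colon \mathbb{R}^m \to \|Y\|$ there exists a point $y\in \|Y\|$ such that $f^{-1}(y)$ intersects every member of $F$.
   Context: For a (locally finite) simplicial complex $Y$, $\|Y\|$ denotes its polyhedron: the underlying topological space, i.e. the union of its simplices with the topology induced by the geometric realization. *)

theory Defs
  imports "HOL-Analysis.Analysis"
begin

text \<open>
  Abstract simplicial complexes, given by their nonempty simplices. The library's
  \<open>simplicial_complex\<close> covers only finite complexes embedded in a Euclidean space.
\<close>

definition abstract_complex :: "'v set set \<Rightarrow> bool" where
  "abstract_complex K \<longleftrightarrow>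
     (\<forall>\<sigma>\<in>K. finite \<sigma> \<and> \<sigma> \<noteq> {}) \<and>
     (\<forall>\<sigma>\<in>K. \<forall>\<tau>. \<tau> \<noteq> {} \<and> \<tau> \<subseteq> \<sigma> \<longrightarrow> \<tau> \<in> K)"

definition locally_finite_complex :: "'v set set \<Rightarrow> bool" where
  "locally_finite_complex K \<longleftrightarrow> (\<forall>v\<in>\<Union>K. finite {\<sigma>\<in>K. v \<in> \<sigma>})"

text \<open>A simplex with \<open>n + 1\<close> vertices has dimension \<open>n\<close>; the top dimension has to be attained.\<close>

definition has_complex_dim :: "'v set set \<Rightarrow> nat \<Rightarrow> bool" where
  "has_complex_dim K d \<longleftrightarrow> (\<forall>\<sigma>\<in>K. card \<sigma> \<le> d + 1) \<and> (\<exists>\<sigma>\<in>K. card \<sigma> = d + 1)"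

text \<open>Points of the geometric realization are encoded by their barycentric coordinates.\<close>

definition geometric_simplex :: "'v set \<Rightarrow> ('v \<Rightarrow> real) set" where
  "geometric_simplex \<sigma> = {x. (\<forall>v. 0 \<le> x v) \<and> (\<forall>v. v \<notin> \<sigma> \<longrightarrow> x v = 0) \<and> (\<Sum>v\<in>\<sigma>. x v) = 1}"

definition realization :: "'v set set \<Rightarrow> ('v \<Rightarrow> real) set" where
  "realization K = (\<Union>\<sigma>\<in>K. geometric_simplex \<sigma>)"

text \<open>
  The topology of the geometric realization is the weak one: a set is open iff it meets every
  closed simplex in a relatively open set. The simplices carry their Euclidean topology, since on
  functions supported in a fixed finite set the product topology of \<^typ>\<open>'v \<Rightarrow> real\<close> is Euclidean.
\<close>

definition realization_topology :: "'v set set \<Rightarrow> ('v \<Rightarrow> real) topology" where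
  "realization_topology K = topology (\<lambda>U. U \<subseteq> realization K \<and>
     (\<forall>\<sigma>\<in>K. openin (top_of_set (geometric_simplex \<sigma>)) (U \<inter> geometric_simplex \<sigma>)))"

lemma openin_realization_topology:
  "openin (realization_topology K) U \<longleftrightarrow> U \<subseteq> realization K \<and>
     (\<forall>\<sigma>\<in>K. openin (top_of_set (geometric_simplex \<sigma>)) (U \<inter> geometric_simplex \<sigma>))"
proof -
  have "istopology (\<lambda>U. U \<subseteq> realization K \<and>
     (\<forall>\<sigma>\<in>K. openin (top_of_set (geometric_simplex \<sigma>)) (U \<inter> geometric_simplex \<sigma>)))"
    unfolding istopology_def
  proof (intro conjI allI impI ballI)
    fix S T \<sigma>
    assume S: "S \<subseteq> realization K \<and>
        (\<forall>\<sigma>\<in>K. openin (top_of_set (geometric_simplex \<sigma>)) (S \<inter> geometric_simplex \<sigma>))"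
      and T: "T \<subseteq> realization K \<and>
        (\<forall>\<sigma>\<in>K. openin (top_of_set (geometric_simplex \<sigma>)) (T \<inter> geometric_simplex \<sigma>))"
    then show "S \<inter> T \<subseteq> realization K" by blast
    assume "\<sigma> \<in> K"
    have "openin (top_of_set (geometric_simplex \<sigma>))
        ((S \<inter> geometric_simplex \<sigma>) \<inter> (T \<inter> geometric_simplex \<sigma>))"
      by (rule openin_Int) (use S T \<open>\<sigma> \<in> K\<close> in \<open>blast+\<close>)
    moreover have "(S \<inter> geometric_simplex \<sigma>) \<inter> (T \<inter> geometric_simplex \<sigma>)
        = S \<inter> T \<inter> geometric_simplex \<sigma>" by blast
    ultimately show "openin (top_of_set (geometric_simplex \<sigma>)) (S \<inter> T \<inter> geometric_simplex \<sigma>)"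
      by simp
  next
    fix \<U> \<sigma>
    assume \<U>: "\<forall>S\<in>\<U>. S \<subseteq> realization K \<and>
        (\<forall>\<sigma>\<in>K. openin (top_of_set (geometric_simplex \<sigma>)) (S \<inter> geometric_simplex \<sigma>))"
    then show "\<Union>\<U> \<subseteq> realization K" by blast
    assume "\<sigma> \<in> K"
    have "openin (top_of_set (geometric_simplex \<sigma>)) (\<Union>((\<lambda>S. S \<inter> geometric_simplex \<sigma>) ` \<U>))"
      by (rule openin_Union) (use \<U> \<open>\<sigma> \<in> K\<close> in blast)
    moreover have "\<Union>((\<lambda>S. S \<inter> geometric_simplex \<sigma>) ` \<U>) = \<Union>\<U> \<inter> geometric_simplex \<sigma>"
      by blast
    ultimately show "openin (top_of_set (geometric_simplex \<sigma>)) (\<Union>\<U> \<inter> geometric_simplex \<sigma>)"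
      by simp
  qed
  from topology_inverse'[OF this] show ?thesis
    unfolding realization_topology_def by (rule fun_cong)
qed

lemma topspace_realization_topology: "topspace (realization_topology K) = realization K"
proof
  show "topspace (realization_topology K) \<subseteq> realization K"
    using openin_realization_topology[of K] openin_topspace by blast
  have "realization K \<inter> geometric_simplex \<sigma> = geometric_simplex \<sigma>" if "\<sigma> \<in> K" for \<sigma>
    using that by (auto simp: realization_def)
  then have "openin (realization_topology K) (realization K)"
    unfolding openin_realization_topology by (metis openin_topspace order_refl topspace_euclidean_subtopology)
  then show "realization K \<subseteq> topspace (realization_topology K)"
    by (rule openin_subset)
qed

end

theory Submission
  imports Defs "HOL-Library.Z2"
begin

text \<open>
  Suppose that no fibre meets all members of \<open>F\<close>. Then every \<open>x\<close> can be labelled by a member of \<open>F\<close>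
  not containing \<open>x\<close>, and because \<open>Y\<close> has dimension \<open>d\<close> this can be done so that sufficiently small
  sets of points carry at most \<open>d + 1\<close> labels. Restrict to the convex hull of points
  \<open>p S \<in> \<Inter>S\<close>, one for each subfamily \<open>S\<close> of at most \<open>d + 1\<close> members. Subdivide simplices finely and
  count, modulo 2, the small simplices whose labels are exactly \<open>S\<close>. This gives a chain map from
  simplices in the hull to the \<open>d\<close>-skeleton of the full simplex on \<open>F\<close>, which sends a simplex lying in
  \<open>C\<close> into the face opposite to \<open>C\<close>. The coefficient at \<open>S\<close> is a cochain vanishing on the simplices
  inside some \<open>C \<in> S\<close>. The complex of such cochains is acyclic, as coning with \<open>p S\<close> preserves the
  simplices inside \<open>C\<close>. So the whole chain map is null-homotopic, although it preserves the
  augmentation: a contradiction.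
\<close>

lemma bit_add_self [simp]: "x + x = 0" "x + (x + y) = y" for x y :: bit
  by (cases x; cases y; simp)+

text \<open>Otherwise the simplifier rewrites sums in \<^typ>\<open>bit\<close> to case distinctions.\<close>
declare add_bit_eq_xor [simp del] mult_bit_eq_and [simp del]

lemma sum_list_concat_map:
  "(\<Sum>t\<leftarrow>concat (map P z). \<phi> t) = (\<Sum>s\<leftarrow>z. \<Sum>t\<leftarrow>P s. \<phi> t)"
  for \<phi> :: "'b \<Rightarrow> 'c::comm_monoid_add"
  by (induction z) auto

lemma sum_list_sum_swap:
  "(\<Sum>s\<leftarrow>z. \<Sum>u\<in>X. \<phi> u s) = (\<Sum>u\<in>X. \<Sum>s\<leftarrow>z. \<phi> u s)"
  for \<phi> :: "'b \<Rightarrow> 'a \<Rightarrow> 'c::comm_monoid_add"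
  by (induction z) (simp_all add: sum.distrib)

subsection \<open>Chains of small tuples modulo 2\<close>

text \<open>
  Simplices are lists of points, with repetitions allowed and \<open>[]\<close> in dimension \<open>- 1\<close>. A chain is a
  list of simplices, of which only the functional \<open>\<phi> \<mapsto> \<Sum>s\<leftarrow>z. \<phi> s\<close> on cochains
  matters. Hence that \<open>w\<close> has boundary \<open>z\<close> is stated by pairing \<open>w\<close> with coboundaries.
\<close>

primrec faces :: "'a list \<Rightarrow> 'a list list" where
  "faces [] = []"
| "faces (q # s) = s # map ((#) q) (faces s)"

lemma length_faces [simp]: "length (faces s) = length s"
  by (induction s) auto

definition cobd :: "('a list \<Rightarrow> bit) \<Rightarrow> 'a list \<Rightarrow> bit" where
  "cobd \<phi> s = (\<Sum>t\<leftarrow>faces s. \<phi> t)"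

lemma cobd_Nil [simp]: "cobd \<phi> [] = 0"
  by (simp add: cobd_def)

lemma cobd_Cons [simp]: "cobd \<phi> (q # s) = \<phi> s + cobd (\<lambda>t. \<phi> (q # t)) s"
  by (simp add: cobd_def o_def)

lemma cobd_zero [simp]: "cobd (\<lambda>t. 0) s = 0"
  by (simp add: cobd_def)

lemma cobd_add: "cobd (\<lambda>t. \<phi> t + \<psi> t) s = cobd \<phi> s + cobd \<psi> s"
  by (simp add: cobd_def sum_list_addf)

lemma cobd_sum: "cobd (\<lambda>t. \<Sum>u\<in>X. \<phi> u t) s = (\<Sum>u\<in>X. cobd (\<phi> u) s)"
proof (induction X rule: infinite_finite_induct)
  case (insert x X)
  then show ?case by (simp add: cobd_add)
qed simp_all

lemma cobd_map: "cobd (\<lambda>t. \<phi> (map h t)) s = cobd \<phi> (map h s)"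
  by (induction s arbitrary: \<phi>) auto

lemma cobd_cobd: "cobd (cobd \<phi>) s = 0"
proof (induction s arbitrary: \<phi>)
  case (Cons q s)
  then show ?case by (simp add: cobd_add)
qed simp

lemma faces_length_subset: "t \<in> set (faces s) \<Longrightarrow> Suc (length t) = length s \<and> set t \<subseteq> set s"
  by (induction s arbitrary: t) fastforce+

lemma cobd_cong:
  assumes "\<And>t. Suc (length t) = length s \<Longrightarrow> set t \<subseteq> set s \<Longrightarrow> \<phi> t = \<psi> t"
  shows "cobd \<phi> s = cobd \<psi> s"
  unfolding cobd_def using assms faces_length_subset
  by (metis (no_types, lifting) map_cong)

text \<open>The standard triangulation of the prism from \<open>g\<close> to \<open>h\<close>: each
  list runs along \<open>g\<close> up to some vertex of \<open>s\<close> and continues from that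
  same vertex along \<open>h\<close>.\<close>

primrec prism :: "('a \<Rightarrow> 'b) \<Rightarrow> ('a \<Rightarrow> 'b) \<Rightarrow> 'a list \<Rightarrow> 'b list list" where
  "prism g h [] = []"
| "prism g h (q # s) = (g q # h q # map h s) # map ((#) (g q)) (prism g h s)"

lemma prism_length_subset:
  "t \<in> set (prism g h s) \<Longrightarrow> length t = Suc (length s) \<and> set t \<subseteq> g ` set s \<union> h ` set s"
  by (induction s arbitrary: t) fastforce+

text \<open>The chain homotopy formula: faces shared by neighbouring lists cancel modulo 2, leaving
  both ends and the prisms over the faces of \<open>s\<close>.\<close>

lemma prism_cobd:
  "(\<Sum>t\<leftarrow>prism g h s. cobd \<phi> t)
     = \<phi> (map g s) + \<phi> (map h s) + cobd (\<lambda>r. \<Sum>t\<leftarrow>prism g h r. \<phi> t) s"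
proof (induction s arbitrary: \<phi>)
  case (Cons q s)
  show ?case
    by (simp add: o_def sum_list_addf Cons.IH cobd_add 
        cobd_map[of "\<lambda>t. \<phi> (g q # h q # t)"] ac_simps)
qed simp

lemma cobd_replicate: "cobd \<phi> (replicate n p) = of_nat n * \<phi> (replicate (n - 1) p)"
proof (induction n arbitrary: \<phi>)
  case (Suc n)
  then show ?case by (cases n) (auto simp: algebra_simps)
qed simp

section \<open>Subdivision into small tuples\<close>

definition small :: "real \<Rightarrow> 'a::metric_space list \<Rightarrow> bool" where
  "small \<epsilon> s \<longleftrightarrow> (\<forall>p\<in>set s. \<forall>q\<in>set s. dist p q < \<epsilon>)"

lemma dist_contract:
  fixes p q p0 :: "'a::real_normed_vector"
  assumes "0 \<le> t" "t \<le> 1"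
  shows "dist (p + t *\<^sub>R (p0 - p)) (q + t *\<^sub>R (p0 - q)) \<le> dist p q"
proof -
  have "p + t *\<^sub>R (p0 - p) - (q + t *\<^sub>R (p0 - q)) = (1 - t) *\<^sub>R (p - q)"
    by (simp add: algebra_simps)
  then have "dist (p + t *\<^sub>R (p0 - p)) (q + t *\<^sub>R (p0 - q)) = (1 - t) * dist p q"
    using assms by (simp add: dist_norm)
  also have "\<dots> \<le> dist p q"
    using assms by (simp add: mult_left_le_one_le)
  finally show ?thesis .
qed

text \<open>
  The straight-line contraction to \<open>p0\<close> is cut into steps so short that the prisms over the
  simplices of \<open>z\<close> are still small; no subdivision is needed. The last step ends in the constant
  simplex at \<open>p0\<close>, which is a boundary if \<open>n\<close> is even and occurs an even number of times
  otherwise.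
\<close>

lemma small_cycle_bounds:
  fixes C :: "'a::real_normed_vector set"
  assumes C: "convex C" "p0 \<in> C" and "0 < \<epsilon>"
    and z: "\<And>s. s \<in> set z \<Longrightarrow> length s = n \<and> set s \<subseteq> C \<and> small \<epsilon> s"
    and cycle: "\<And>\<phi>. (\<Sum>s\<leftarrow>z. cobd \<phi> s) = 0"
  shows "\<exists>w. (\<forall>t\<in>set w. length t = Suc n \<and> set t \<subseteq> C \<and> small \<epsilon> t)
           \<and> (\<forall>\<phi>. (\<Sum>t\<leftarrow>w. cobd \<phi> t) = (\<Sum>s\<leftarrow>z. \<phi> s))"
proof -
  define P where "P = (\<Union>s\<in>set z. set s)"
  define D where "D = insert 0 (\<Union>s\<in>set z. (\<lambda>(p, q). dist p q) ` (set s \<times> set s))"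
  define \<mu> where "\<mu> = Max D"
  have "finite D" "D \<noteq> {}" by (auto simp: D_def)
  then have "\<mu> \<in> D" unfolding \<mu>_def by (rule Max_in)
  then have "\<mu> < \<epsilon>"
    using z \<open>0 < \<epsilon>\<close> unfolding D_def small_def by fastforce
  have dist\<mu>: "dist p q \<le> \<mu>" if "s \<in> set z" "p \<in> set s" "q \<in> set s" for s p q
    unfolding \<mu>_def using \<open>finite D\<close> by (rule Max_ge) (use that in \<open>force simp: D_def\<close>)
  have "bounded P" by (simp add: P_def finite_imp_bounded)
  then obtain R where R: "\<And>p. p \<in> P \<Longrightarrow> dist p0 p \<le> R" "R > 0"
    by (metis bounded_any_center dual_order.strict_trans2 gt_ex less_eq_real_def linorder_not_le order_trans)
  \<comment> \<open>One step moves a point by at most \<open>R / N\<close>; added to the diameter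
    bound \<open>\<mu>\<close>, this must stay below \<open>\<epsilon>\<close>.\<close>
  obtain N :: nat where N: "R / (\<epsilon> - \<mu>) < real N"
    using reals_Archimedean2 by blast
  then have "0 < real N"
    using \<open>\<mu> < \<epsilon>\<close> R(2) by (smt (verit) divide_pos_pos)
  with N have N': "R / real N < \<epsilon> - \<mu>" "0 < N"
    using \<open>\<mu> < \<epsilon>\<close> by (auto simp: field_simps)
  define H where "H j p = p + (real j / real N) *\<^sub>R (p0 - p)" for j p
  have H0: "H 0 = id" and HN: "H N = (\<lambda>_. p0)"
    using \<open>0 < N\<close> by (auto simp: H_def fun_eq_iff)
  have HC: "H j p \<in> C" if "p \<in> C" "j \<le> N" for j p
  proof -
    have "H j p = (1 - real j / real N) *\<^sub>R p + (real j / real N) *\<^sub>R p0"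
      by (simp add: H_def algebra_simps)
    also have "\<dots> \<in> C"
      using that \<open>0 < N\<close> C by (intro convexD) auto
    finally show ?thesis .
  qed
  have H_same: "dist (H j p) (H j q) \<le> \<mu>"
    if "s \<in> set z" "p \<in> set s" "q \<in> set s" "j \<le> N" for s p q j
    using dist_contract[of "real j / real N" p p0 q] dist\<mu>[OF that(1-3)] that(4) \<open>0 < N\<close>
    by (simp add: H_def)
  have H_step: "dist (H j q) (H (Suc j) q) \<le> R / real N"
    if "s \<in> set z" "q \<in> set s" for s q j
  proof -
    have "H j q - H (Suc j) q = (real j / real N - real (Suc j) / real N) *\<^sub>R (p0 - q)"
      unfolding H_def by (simp only: scaleR_diff_left) simp
    also have "real j / real N - real (Suc j) / real N = - 1 / real N"
      using \<open>0 < N\<close> by (simp add: field_simps)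
    finally have "dist (H j q) (H (Suc j) q) = dist p0 q / real N"
      by (simp add: dist_norm)
    also have "\<dots> \<le> R / real N"
      using R(1)[of q] that \<open>0 < N\<close> by (intro divide_right_mono) (auto simp: P_def)
    finally show ?thesis .
  qed
  have H_diff: "dist (H j p) (H (Suc j) q) < \<epsilon>"
    if "s \<in> set z" "p \<in> set s" "q \<in> set s" "j < N" for s p q j
    using dist_triangle[of "H j p" "H (Suc j) q" "H j q"] H_same[OF that(1-3), of j] H_step[OF that(1,3), of j]
      that(4) N' by linarith
  define w1 where "w1 = concat (map (\<lambda>j. concat (map (prism (H j) (H (Suc j))) z)) [0..<N])"
  have w1: "length t = Suc n \<and> set t \<subseteq> C \<and> small \<epsilon> t" if "t \<in> set w1" for t
  proof -
    from that obtain j s where js: "j < N" "s \<in> set z" "t \<in> set (prism (H j) (H (Suc j)) s)"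
      by (auto simp: w1_def)
    have l: "length t = Suc (length s)" and sub: "set t \<subseteq> H j ` set s \<union> H (Suc j) ` set s"
      using prism_length_subset[OF js(3)] by auto
    have "dist a b < \<epsilon>" if "a \<in> set t" "b \<in> set t" for a b
      using subsetD[OF sub that(1)] subsetD[OF sub that(2)] H_same[OF js(2), of _ _ j] H_same[OF js(2), of _ _ "Suc j"]
        H_diff[OF js(2) _ _ js(1)] \<open>\<mu> < \<epsilon>\<close> js(1)
      by (elim UnE imageE) (fastforce simp: dist_commute)+
    moreover have "set t \<subseteq> C"
      using sub z[OF js(2)] HC js(1) by fastforce
    ultimately show ?thesis
      using l z[OF js(2)] by (simp add: small_def)
  qed
  have step: "(\<Sum>t\<leftarrow>concat (map (prism (H j) (H (Suc j))) z). cobd \<phi> t)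
      = (\<Sum>s\<leftarrow>z. \<phi> (map (H j) s)) + (\<Sum>s\<leftarrow>z. \<phi> (map (H (Suc j)) s))" for j \<phi>
    by (simp add: sum_list_concat_map prism_cobd sum_list_addf cycle)
  have w1_sum: "(\<Sum>t\<leftarrow>w1. cobd \<phi> t) = (\<Sum>s\<leftarrow>z. \<phi> s) + (\<Sum>s\<leftarrow>z. \<phi> (replicate n p0))" for \<phi>
  proof -
    have "(\<Sum>t\<leftarrow>concat (map (\<lambda>j. concat (map (prism (H j) (H (Suc j))) z)) [0..<k]). cobd \<phi> t)
        = (\<Sum>s\<leftarrow>z. \<phi> (map (H 0) s)) + (\<Sum>s\<leftarrow>z. \<phi> (map (H k) s))" for k
    proof (induction k)
      case (Suc k)
      then show ?case using step[of \<phi> k] by (simp add: ac_simps)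
    qed simp
    moreover have "(\<Sum>s\<leftarrow>z. \<phi> (map (H N) s)) = (\<Sum>s\<leftarrow>z. \<phi> (replicate n p0))"
      by (intro arg_cong[of _ _ sum_list] map_cong refl) (simp add: HN map_replicate_const z)
    ultimately show ?thesis by (simp add: w1_def H0)
  qed
  define w2 where "w2 = (if even n then replicate (length z) (replicate (Suc n) p0) else [])"
  have "(\<Sum>t\<leftarrow>w2. cobd \<phi> t) = (\<Sum>s\<leftarrow>z. \<phi> (replicate n p0))" for \<phi>
  proof (cases "even n")
    case True
    then have "of_nat (Suc n) = (1::bit)" by (auto elim: evenE)
    then have "cobd \<phi> (replicate (Suc n) p0) = \<phi> (replicate n p0)"
      by (simp add: cobd_replicate del: replicate_Suc of_nat_Suc)
    then show ?thesis
      using True by (simp add: w2_def sum_list_replicate sum_list_triv del: replicate_Suc cobd_Cons)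
  next
    case False
    then have n1: "of_nat n = (1::bit)" by (auto elim: oddE)
    \<comment> \<open>Each simplex has an odd number of faces, so pairing with the constant cochain
      \<open>1\<close> shows that \<open>z\<close> has even length.\<close>
    have "cobd (\<lambda>_. 1) s = 1" if "s \<in> set z" for s
      using z[OF that] n1 by (simp add: cobd_def sum_list_triv) 
    then have "(\<Sum>s\<leftarrow>z. cobd (\<lambda>_. 1) s) = of_nat (length z)"
      by (simp add: sum_list_triv cong: map_cong)
    with cycle[of "\<lambda>_. 1"] show ?thesis
      using False by (simp add: w2_def sum_list_triv)
  qed
  moreover have "length t = Suc n \<and> set t \<subseteq> C \<and> small \<epsilon> t" if "t \<in> set w2" for t
    using that C \<open>0 < \<epsilon>\<close> by (auto simp: w2_def small_def split: if_splits)
  ultimately show ?thesis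
    using w1 w1_sum by (intro exI[of _ "w1 @ w2"]) (auto simp: ac_simps)
qed

text \<open>Built one dimension at a time: the subdivided boundary of \<open>\<tau>\<close> is a
  small cycle in the convex hull of \<open>\<tau>\<close>, so it bounds a small chain there.\<close>

lemma small_subdivision:
  fixes \<epsilon> :: real
  assumes "0 < \<epsilon>"
  obtains c :: "'a::real_normed_vector list \<Rightarrow> 'a list list"
  where "c [] = [[]]"
    and "\<And>\<tau> s. s \<in> set (c \<tau>) \<Longrightarrow>
           length s = length \<tau> \<and> set s \<subseteq> convex hull (set \<tau>) \<and> small \<epsilon> s"
    and "\<And>\<tau> \<phi>. (\<Sum>s\<leftarrow>c \<tau>. cobd \<phi> s) = cobd (\<lambda>\<sigma>. \<Sum>s\<leftarrow>c \<sigma>. \<phi> s) \<tau>"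
proof -
  let ?sub = "\<lambda>s \<tau>::'a list. length s = length \<tau> \<and> set s \<subseteq> convex hull (set \<tau>) \<and> small \<epsilon> s"
  \<comment> \<open>\<open>P\<close> includes what the next extension needs: over the faces of a
    tuple with one more entry, the values add up to a cycle.\<close>
  define P :: "nat \<Rightarrow> ('a list \<Rightarrow> 'a list list) \<Rightarrow> bool" where
    "P n g \<longleftrightarrow> (\<forall>\<tau>. length \<tau> = n \<longrightarrow> (\<forall>s\<in>set (g \<tau>). ?sub s \<tau>))
       \<and> (\<forall>\<tau> \<phi>. length \<tau> = Suc n \<longrightarrow> cobd (\<lambda>\<sigma>. \<Sum>s\<leftarrow>g \<sigma>. cobd \<phi> s) \<tau> = 0)
       \<and> (n = 0 \<longrightarrow> g [] = [[]])" for n g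
  define Q :: "nat \<Rightarrow> ('a list \<Rightarrow> 'a list list) \<Rightarrow> ('a list \<Rightarrow> 'a list list) \<Rightarrow> bool" where
    "Q n g g' \<longleftrightarrow> (\<forall>\<tau> \<phi>. length \<tau> = Suc n \<longrightarrow>
        (\<Sum>s\<leftarrow>g' \<tau>. cobd \<phi> s) = cobd (\<lambda>\<sigma>. \<Sum>s\<leftarrow>g \<sigma>. \<phi> s) \<tau>)" for n g g'
  have "P 0 (\<lambda>_. [[]])"
    by (simp add: P_def small_def)
  moreover have "\<exists>g'. P (Suc n) g' \<and> Q n g g'" if g: "P n g" for n g
  proof -
    have "\<exists>w. (\<forall>s\<in>set w. ?sub s \<tau>) \<and> (\<forall>\<phi>. (\<Sum>s\<leftarrow>w. cobd \<phi> s) = cobd (\<lambda>\<sigma>. \<Sum>s\<leftarrow>g \<sigma>. \<phi> s) \<tau>)"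
      if \<tau>: "length \<tau> = Suc n" for \<tau>
    proof -
      define z where "z = concat (map g (faces \<tau>))"
      have z_sum: "(\<Sum>s\<leftarrow>z. \<phi> s) = cobd (\<lambda>\<sigma>. \<Sum>s\<leftarrow>g \<sigma>. \<phi> s) \<tau>" for \<phi>
        by (simp add: z_def cobd_def sum_list_concat_map)
      have "hd \<tau> \<in> convex hull (set \<tau>)"
        using \<tau> by (cases \<tau>) (auto simp: hull_inc)
      moreover have "length s = n \<and> set s \<subseteq> convex hull (set \<tau>) \<and> small \<epsilon> s" if "s \<in> set z" for s
      proof -
        from that obtain \<sigma> where \<sigma>: "\<sigma> \<in> set (faces \<tau>)" "s \<in> set (g \<sigma>)"
          by (auto simp: z_def)
        have l: "length \<sigma> = n" and "set \<sigma> \<subseteq> set \<tau>"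
          using faces_length_subset[OF \<sigma>(1)] \<tau> by auto
        then have "convex hull (set \<sigma>) \<subseteq> convex hull (set \<tau>)"
          by (intro hull_mono)
        moreover have "?sub s \<sigma>"
          using g l \<sigma>(2) unfolding P_def by blast
        ultimately show ?thesis
          using l by blast
      qed
      moreover have "(\<Sum>s\<leftarrow>z. cobd \<phi> s) = 0" for \<phi>
        using g \<tau> by (simp add: z_sum P_def)
      ultimately show ?thesis
        using small_cycle_bounds[OF convex_convex_hull _ \<open>0 < \<epsilon>\<close>, of "hd \<tau>" "set \<tau>" z n] \<tau>
        by (simp add: z_sum)
    qed
    then have "\<forall>\<tau>. \<exists>w. length \<tau> = Suc n \<longrightarrow> (\<forall>s\<in>set w. ?sub s \<tau>) \<and>
        (\<forall>\<phi>. (\<Sum>s\<leftarrow>w. cobd \<phi> s) = cobd (\<lambda>\<sigma>. \<Sum>s\<leftarrow>g \<sigma>. \<phi> s) \<tau>)"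
      by blast
    from choice[OF this] obtain g' where g':
      "\<And>\<tau>. length \<tau> = Suc n \<Longrightarrow> (\<forall>s\<in>set (g' \<tau>). ?sub s \<tau>)"
      "\<And>\<tau> \<phi>. length \<tau> = Suc n \<Longrightarrow> (\<Sum>s\<leftarrow>g' \<tau>. cobd \<phi> s) = cobd (\<lambda>\<sigma>. \<Sum>s\<leftarrow>g \<sigma>. \<phi> s) \<tau>"
      by blast
    have "cobd (\<lambda>\<sigma>. \<Sum>s\<leftarrow>g' \<sigma>. cobd \<phi> s) \<tau> = 0" if "length \<tau> = Suc (Suc n)" for \<tau> \<phi>
    proof -
      have "cobd (\<lambda>\<sigma>. \<Sum>s\<leftarrow>g' \<sigma>. cobd \<phi> s) \<tau> = cobd (cobd (\<lambda>\<sigma>. \<Sum>s\<leftarrow>g \<sigma>. \<phi> s)) \<tau>"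
        by (rule cobd_cong) (use g'(2) that in simp)
      then show ?thesis by (simp add: cobd_cobd)
    qed
    with g' have "P (Suc n) g'" "Q n g g'"
      by (auto simp: P_def Q_def)
    then show ?thesis by blast
  qed
  ultimately have "\<exists>G. \<forall>n. P n (G n) \<and> Q n (G n) (G (Suc n))"
    by (intro dependent_nat_choice[of P Q]) auto
  then obtain G where G: "\<And>n. P n (G n)" "\<And>n. Q n (G n) (G (Suc n))"
    by blast
  define c where "c \<tau> = G (length \<tau>) \<tau>" for \<tau>
  show ?thesis
  proof (rule that[of c])
    show "c [] = [[]]"
      using G(1)[of 0] by (simp add: P_def c_def)
    show "?sub s \<tau>" if "s \<in> set (c \<tau>)" for s \<tau>
      using G(1)[of "length \<tau>"] that unfolding P_def c_def by blast
    show "(\<Sum>s\<leftarrow>c \<tau>. cobd \<phi> s) = cobd (\<lambda>\<sigma>. \<Sum>s\<leftarrow>c \<sigma>. \<phi> s) \<tau>" for \<tau> \<phi>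
    proof (cases \<tau>)
      case Nil
      then show ?thesis using \<open>c [] = [[]]\<close> by simp
    next
      case (Cons q \<rho>)
      then have "length \<tau> = Suc (length \<rho>)" by simp
      moreover have "cobd (\<lambda>\<sigma>. \<Sum>s\<leftarrow>c \<sigma>. \<phi> s) \<tau> = cobd (\<lambda>\<sigma>. \<Sum>s\<leftarrow>G (length \<rho>) \<sigma>. \<phi> s) \<tau>"
        by (rule cobd_cong) (simp add: c_def Cons)
      ultimately show ?thesis
        using G(2)[of "length \<rho>"] unfolding Q_def by (simp only: c_def)
    qed
  qed
qed

subsection \<open>The combinatorial obstruction\<close>

text \<open>As a functional on chains, this reads off the coefficient of the unordered simplex
  \<open>S\<close>, lists with repetitions counting as degenerate.\<close>

definition rainbow :: "'b set \<Rightarrow> 'b list \<Rightarrow> bit" where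
  "rainbow S l = of_bool (distinct l \<and> set l = S)"

lemma rainbow_Cons: "rainbow S (q # l) = (if q \<in> S then rainbow (S - {q}) l else 0)"
  by (auto simp: rainbow_def)

text \<open>Passing to unordered simplices is a chain map: the faces dropping either copy of a
  doubled label cancel modulo 2, and in a list without repetitions each label is dropped by exactly
  one face.\<close>

lemma cobd_rainbow:
  assumes "finite U" "set l \<subseteq> U"
  shows "cobd (rainbow S) l = (\<Sum>u\<in>U - S. rainbow (insert u S) l)"
  using assms(2)
proof (induction l arbitrary: S)
  case Nil
  then show ?case by (simp add: rainbow_def)
next
  case (Cons q l)
  then have "q \<in> U" "set l \<subseteq> U" by auto
  note IH = Cons.IH[OF this(2)]
  show ?case
  proof (cases "q \<in> S")
    case True
    then have "U - (S - {q}) = insert q (U - S)" "q \<notin> U - S" "insert q (S - {q}) = S"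
      using \<open>q \<in> U\<close> by auto
    then have "cobd (rainbow S) (q # l) = (\<Sum>u\<in>U - S. rainbow (insert u (S - {q})) l)"
      using True IH \<open>finite U\<close> by (simp add: rainbow_Cons)
    also have "\<dots> = (\<Sum>u\<in>U - S. rainbow (insert u S) (q # l))"
      using True by (intro sum.cong refl) (auto simp: rainbow_Cons insert_Diff_if)
    finally show ?thesis .
  next
    case False
    have "(\<Sum>u\<in>U - S. rainbow (insert u S) (q # l)) = (\<Sum>u\<in>U - S. if u = q then rainbow S l else 0)"
      using False by (intro sum.cong refl) (auto simp: rainbow_Cons)
    also have "\<dots> = rainbow S l"
      using False \<open>q \<in> U\<close> \<open>finite U\<close> by simp
    finally show ?thesis
      using False by (simp add: rainbow_Cons)
  qed
qed

lemma sum_symmetric_off_diagonal: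
  fixes g :: "'b \<Rightarrow> 'b \<Rightarrow> bit"
  assumes "finite X" "\<And>u v. g u v = g v u"
  shows "(\<Sum>u\<in>X. \<Sum>v\<in>X - {u}. g u v) = 0"
  using assms(1)
proof (induction X)
  case (insert x X)
  have "(\<Sum>u\<in>X. \<Sum>v\<in>insert x X - {u}. g u v) = (\<Sum>u\<in>X. g u x + (\<Sum>v\<in>X - {u}. g u v))"
  proof (rule sum.cong[OF refl])
    fix u assume "u \<in> X"
    then have "insert x X - {u} = insert x (X - {u})" "x \<notin> X - {u}"
      using insert.hyps by auto
    then show "(\<Sum>v\<in>insert x X - {u}. g u v) = g u x + (\<Sum>v\<in>X - {u}. g u v)"
      using insert.hyps by simp
  qed
  moreover have "insert x X - {x} = X"
    using insert.hyps by auto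
  ultimately show ?case
    using insert by (simp add: sum.distrib assms(2)[of x])
qed simp

text \<open>The bound \<open>d + 1\<close> enters twice: larger subfamilies never occur as label
  sets of small tuples, and those that may occur have a common point to cone with.\<close>

lemma few_labels_contradiction:
  fixes F :: "'a::real_normed_vector set set"
  assumes "convex K" "finite F" "\<And>C. C \<in> F \<Longrightarrow> convex C"
    and p: "\<And>S. S \<subseteq> F \<Longrightarrow> card S \<le> d + 1 \<Longrightarrow> p S \<in> K \<inter> \<Inter>S"
    and lab: "\<And>x. x \<in> K \<Longrightarrow> lab x \<in> F \<and> x \<notin> lab x"
    and "0 < \<epsilon>"
    and few: "\<And>s. small \<epsilon> s \<Longrightarrow> set s \<subseteq> K \<Longrightarrow> card (lab ` set s) \<le> d + 1"
  shows False
proof -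
  obtain c :: "'a list \<Rightarrow> 'a list list" where c0: "c [] = [[]]"
    and c: "\<And>\<tau> s. s \<in> set (c \<tau>) \<Longrightarrow>
           length s = length \<tau> \<and> set s \<subseteq> convex hull (set \<tau>) \<and> small \<epsilon> s"
    and cb: "\<And>\<tau> \<phi>. (\<Sum>s\<leftarrow>c \<tau>. cobd \<phi> s) = cobd (\<lambda>\<sigma>. \<Sum>s\<leftarrow>c \<sigma>. \<phi> s) \<tau>"
    using small_subdivision[OF \<open>0 < \<epsilon>\<close>] by blast
  have c_in: "set s \<subseteq> X" if "s \<in> set (c \<tau>)" "set \<tau> \<subseteq> X" "convex X" for s \<tau> X
    using c[OF that(1)] hull_minimal[of "set \<tau>" X convex] that(2,3) by blast
  define a where "a S \<tau> = (\<Sum>s\<leftarrow>c \<tau>. rainbow S (map lab s))" for S \<tau>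
  have cobd_a: "cobd (a S) \<tau> = (\<Sum>u\<in>F - S. a (insert u S) \<tau>)" if "set \<tau> \<subseteq> K" for S \<tau>
  proof -
    have "cobd (a S) \<tau> = (\<Sum>s\<leftarrow>c \<tau>. cobd (\<lambda>t. rainbow S (map lab t)) s)"
      unfolding a_def cb ..
    also have "\<dots> = (\<Sum>s\<leftarrow>c \<tau>. \<Sum>u\<in>F - S. rainbow (insert u S) (map lab s))"
    proof (intro arg_cong[of _ _ sum_list] map_cong refl)
      fix s assume "s \<in> set (c \<tau>)"
      then have "set (map lab s) \<subseteq> F"
        using c_in[OF _ that \<open>convex K\<close>] lab by fastforce
      then show "cobd (\<lambda>t. rainbow S (map lab t)) s = (\<Sum>u\<in>F - S. rainbow (insert u S) (map lab s))"
        by (simp add: cobd_map cobd_rainbow[OF \<open>finite F\<close>])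
    qed
    also have "\<dots> = (\<Sum>u\<in>F - S. a (insert u S) \<tau>)"
      unfolding a_def by (rule sum_list_sum_swap)
    finally show ?thesis .
  qed
  have a_many: "a S \<tau> = 0" if "set \<tau> \<subseteq> K" "card S = d + 2" for S \<tau>
  proof -
    have "rainbow S (map lab s) = 0" if "s \<in> set (c \<tau>)" for s
      using few[of s] c[OF that] c_in[OF that \<open>set \<tau> \<subseteq> K\<close> \<open>convex K\<close>] \<open>card S = d + 2\<close>
      by (auto simp: rainbow_def)
    then show ?thesis by (simp add: a_def cong: map_cong)
  qed
  \<comment> \<open>Convexity keeps the subdivision of \<open>\<tau>\<close> inside
    \<open>C\<close>, where the label \<open>C\<close> never occurs.\<close>
  have a_avoid: "a S \<tau> = 0" if "set \<tau> \<subseteq> K \<inter> C" "C \<in> S" "C \<in> F" for S \<tau> C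
  proof -
    have "rainbow S (map lab s) = 0" if "s \<in> set (c \<tau>)" for s
    proof -
      have "set s \<subseteq> K \<inter> C"
        using c_in[OF that \<open>set \<tau> \<subseteq> K \<inter> C\<close>] assms(1,3) \<open>C \<in> F\<close> by (simp add: convex_Int)
      then have "C \<notin> set (map lab s)"
        using lab by fastforce
      then show ?thesis
        using \<open>C \<in> S\<close> by (auto simp: rainbow_def)
    qed
    then show ?thesis by (simp add: a_def cong: map_cong)
  qed
  txt \<open>
    Read \<open>a S\<close> as a cochain of dimension \<open>card S - 1\<close>. Coning with \<open>p S\<close> contracts the cochains
    that vanish on every tuple lying in some \<open>C \<in> S\<close>. From the top dimension
    \<open>card S = d + 1\<close> downwards, \<open>T\<close> corrects \<open>a\<close> by these cones into cocycles. In dimension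
    \<open>- 1\<close> the corrections are zero, so \<open>T (d + 2) {}\<close> is \<open>1\<close> on the empty tuple, which is not
    a cocycle.
  \<close>
  define T where "T = rec_nat (\<lambda>S \<tau>. 0)
    (\<lambda>j T' S \<tau>. a S \<tau> + (\<Sum>u\<in>F - S. T' (insert u S) (p (insert u S) # \<tau>)))"
  have T0: "T 0 = (\<lambda>S \<tau>. 0)"
    and TSuc: "T (Suc j) = (\<lambda>S \<tau>. a S \<tau> + (\<Sum>u\<in>F - S. T j (insert u S) (p (insert u S) # \<tau>)))" for j
    by (simp_all add: T_def)
  have card_insert_F: "insert u S \<subseteq> F \<and> card (insert u S) = Suc (card S)"
    if "S \<subseteq> F" "u \<in> F - S" for u S
    using that \<open>finite F\<close> by (auto simp: finite_subset)
  have T_avoid: "T j S \<tau> = 0"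
    if "card S + j = d + 2" "S \<subseteq> F" "C \<in> S" "set \<tau> \<subseteq> K \<inter> C" for j S \<tau> C
    using that
  proof (induction j arbitrary: S \<tau>)
    case 0
    then show ?case by (simp add: T0)
  next
    case (Suc j)
    \<comment> \<open>For \<open>j = 0\<close> the family \<open>insert u S\<close> has
      \<open>d + 2\<close> members and \<open>p\<close> need not give a common point; there
      \<open>T 0\<close> vanishes instead.\<close>
    have "T j (insert u S) (p (insert u S) # \<tau>) = 0" if "u \<in> F - S" for u
    proof (cases j)
      case 0
      then show ?thesis by (simp add: T0)
    next
      case (Suc j')
      note * = card_insert_F[OF Suc.prems(2) that]
      then have "p (insert u S) \<in> K \<inter> \<Inter>(insert u S)"
        using Suc.prems(1) \<open>j = Suc j'\<close> by (intro p) auto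
      then show ?thesis
        using * Suc.prems by (intro Suc.IH) auto
    qed
    then show ?case
      using a_avoid[of \<tau> C S] Suc.prems by (auto simp: TSuc)
  qed
  have T_cocycle: "cobd (T j S) \<tau> = 0"
    if "card S + j = d + 2" "S \<subseteq> F" "set \<tau> \<subseteq> K" for j S \<tau>
    using that
  proof (induction j arbitrary: S \<tau>)
    case 0
    then show ?case by (simp add: T0)
  next
    case (Suc j)
    \<comment> \<open>Coning inverts the coboundary on cocycles, as the face of
      \<open>p (insert u S) # \<tau>\<close> opposite the cone point is
      \<open>\<tau>\<close>.\<close>
    have cone: "cobd (\<lambda>t. T j (insert u S) (p (insert u S) # t)) \<tau> = T j (insert u S) \<tau>"
      if "u \<in> F - S" for u
    proof (cases j)
      case 0
      then show ?thesis by (simp add: T0)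
    next
      case (Suc j')
      note * = card_insert_F[OF Suc.prems(2) that]
      then have "p (insert u S) \<in> K \<inter> \<Inter>(insert u S)"
        using Suc.prems(1) \<open>j = Suc j'\<close> by (intro p) auto
      then have "cobd (T j (insert u S)) (p (insert u S) # \<tau>) = 0"
        using * Suc.prems by (intro Suc.IH) auto
      then have "T j (insert u S) \<tau> + cobd (\<lambda>t. T j (insert u S) (p (insert u S) # t)) \<tau> = 0"
        by simp
      then show ?thesis
        by (metis add_0_right bit_add_self(2))
    qed
    have "cobd (T (Suc j) S) \<tau> = (\<Sum>u\<in>F - S. a (insert u S) \<tau> + T j (insert u S) \<tau>)"
      using cone Suc.prems(3) by (simp add: TSuc cobd_add cobd_sum cobd_a sum.distrib)
    also have "\<dots> = 0"
    proof (cases j)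
      case 0
      then have "a (insert u S) \<tau> = 0" if "u \<in> F - S" for u
        using a_many card_insert_F[OF Suc.prems(2) that] Suc.prems by auto
      with 0 show ?thesis by (simp add: T0)
    next
      case (Suc j')
      \<comment> \<open>Expanding \<open>T j\<close> yields a second copy of
        \<open>a (insert u S) \<tau>\<close>, which cancels the first. The remaining double sum is
        symmetric, since only the set with both \<open>u\<close> and \<open>v\<close> inserted
        matters.\<close>
      define g where "g u v = T j' (insert v (insert u S)) (p (insert v (insert u S)) # \<tau>)" for u v
      have "F - insert u S = F - S - {u}" for u by auto
      then have "(\<Sum>u\<in>F - S. a (insert u S) \<tau> + T j (insert u S) \<tau>) = (\<Sum>u\<in>F - S. \<Sum>v\<in>F - S - {u}. g u v)"
        by (simp add: Suc TSuc g_def)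
      also have "\<dots> = 0"
        using \<open>finite F\<close> by (intro sum_symmetric_off_diagonal) (auto simp: g_def insert_commute)
      finally show ?thesis .
    qed
    finally show ?case .
  qed
  have "p {} \<in> K" using p[of "{}"] by simp
  \<comment> \<open>On a one-point tuple the coboundary is the value at \<open>[]\<close>. Unfolded,
    that value is \<open>a {} [] = 1\<close> plus corrections, which vanish because
    \<open>p {u}\<close> lies in \<open>u\<close>.\<close>
  then have "T (d + 2) {} [] = 0"
    using T_cocycle[of "{}" "d + 2" "[p {}]"] by simp
  moreover have "T (d + 1) {u} [p {u}] = 0" if "u \<in> F" for u
    using that p[of "{u}"] by (intro T_avoid[of _ _ u]) auto
  ultimately show False
    by (simp add: TSuc a_def c0 rainbow_def)
qed

subsection \<open>Labels from a map into a complex\<close>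

text \<open>
  A lattice point \<open>z\<close> is counted here iff its hat function in the Freudenthal triangulation is
  positive at \<open>s\<close>. It is recovered from the fractional part \<open>\<theta> = Max (s i - z i)\<close>,
  as \<open>z i = \<lceil>s i - \<theta>\<rceil>\<close>.
\<close>

lemma card_lattice_le:
  fixes s :: "nat \<Rightarrow> real"
  assumes "s 0 = 0"
  shows "finite {z. z 0 = 0 \<and> (\<forall>i>M. z i = 0) \<and> (\<forall>i\<le>M. \<forall>j\<le>M. s i - of_int (z i) - (s j - of_int (z j)) < 1)}
       \<and> card {z. z 0 = 0 \<and> (\<forall>i>M. z i = 0) \<and> (\<forall>i\<le>M. \<forall>j\<le>M. s i - of_int (z i) - (s j - of_int (z j)) < 1)}
           \<le> card ((\<lambda>i. frac (s i)) ` {..M})" (is "finite ?Z \<and> _")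
proof -
  define \<theta> where "\<theta> z = Max ((\<lambda>i. s i - of_int (z i)) ` {..M})" for z :: "nat \<Rightarrow> int"
  have \<theta>_ge: "s i - of_int (z i) \<le> \<theta> z" if "i \<le> M" for z i
    unfolding \<theta>_def using that by (intro Max_ge) auto
  have \<theta>_eq: "\<exists>i\<le>M. \<theta> z = s i - of_int (z i)" for z
  proof -
    have "\<theta> z \<in> (\<lambda>i. s i - of_int (z i)) ` {..M}"
      unfolding \<theta>_def by (rule Max_in) auto
    then show ?thesis by blast
  qed
  have inj: "inj_on \<theta> ?Z"
  proof (rule inj_onI)
    fix z z' assume z: "z \<in> ?Z" "z' \<in> ?Z" "\<theta> z = \<theta> z'"
    have *: "z i = \<lceil>s i - \<theta> z\<rceil>" if "i \<le> M" "z \<in> ?Z" for i z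
    proof -
      obtain j where "j \<le> M" "\<theta> z = s j - of_int (z j)"
        using \<theta>_eq by blast
      with that have "\<theta> z - (s i - of_int (z i)) < 1"
        by auto
      with \<theta>_ge[OF that(1), of z] show ?thesis
        by linarith
    qed
    show "z = z'"
    proof
      fix i show "z i = z' i"
        using *[of i z] *[of i z'] z by (cases "i \<le> M") auto
    qed
  qed
  have sub: "\<theta> ` ?Z \<subseteq> (\<lambda>i. frac (s i)) ` {..M}"
  proof
    fix t assume "t \<in> \<theta> ` ?Z"
    then obtain z where z: "z \<in> ?Z" "t = \<theta> z" by blast
    obtain j where j: "j \<le> M" "\<theta> z = s j - of_int (z j)"
      using \<theta>_eq by blast
    \<comment> \<open>Comparing with index \<open>0\<close>, where \<open>s\<close> and
      \<open>z\<close> vanish, puts \<open>\<theta> z\<close> between 0 and 1, so it is the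
      fractional part of \<open>s j\<close>.\<close>
    have "s j - of_int (z j) - (s 0 - of_int (z 0)) < 1"
      using z(1) j(1) by blast
    then have "0 \<le> \<theta> z" "\<theta> z < 1"
      using \<theta>_ge[of 0 z] z(1) j assms by auto
    with j have "\<lfloor>s j\<rfloor> = z j"
      by linarith
    then show "t \<in> (\<lambda>i. frac (s i)) ` {..M}"
      using z(2) j by (intro image_eqI[of _ _ j]) (auto simp: frac_def)
  qed
  have fin: "finite ((\<lambda>i. frac (s i)) ` {..M})"
    by simp
  show ?thesis
    by (rule conjI[OF inj_on_finite[OF inj sub fin] card_inj_on_le[OF inj sub fin]])
qed

text \<open>Partial sums change only after a nonzero \<open>b i\<close>. The initial value 0 adds no
  further fractional part, since the total \<open>N\<close> is an integer and, being positive, is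
  reached after a nonzero term.\<close>

lemma card_frac_partial_sums:
  fixes b :: "nat \<Rightarrow> real"
  assumes "(\<Sum>i<M. b i) = of_nat N" "0 < N"
  shows "card ((\<lambda>i. frac (\<Sum>k<i. b k)) ` {..M}) \<le> card {i. i < M \<and> b i \<noteq> 0}"
proof -
  let ?J = "{i. i < M \<and> b i \<noteq> 0}"
  let ?s = "\<lambda>i. \<Sum>k<i. b k"
  have *: "?s i = 0 \<or> (\<exists>k\<in>?J. ?s i = ?s (Suc k))" if "i \<le> M" for i
    using that
  proof (induction i)
    case (Suc i)
    show ?case
    proof (cases "b i = 0")
      case True
      with Suc show ?thesis by simp
    next
      case False
      with Suc.prems have "i \<in> ?J" by simp
      then show ?thesis by blast
    qed
  qed simp
  obtain k0 where k0: "k0 \<in> ?J" "?s (Suc k0) = of_nat N"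
    using *[of M] assms by auto
  then have "frac (?s (Suc k0)) = 0"
    by (simp del: sum.lessThan_Suc)
  then have "frac (?s i) \<in> (\<lambda>k. frac (?s (Suc k))) ` ?J" if "i \<le> M" for i
    using *[OF that] k0(1) by (auto simp del: sum.lessThan_Suc)
  then have "(\<lambda>i. frac (?s i)) ` {..M} \<subseteq> (\<lambda>k. frac (?s (Suc k))) ` ?J"
    by blast
  then show ?thesis
    by (rule surj_card_le[rotated]) simp
qed

section \<open>Consequences of compactness\<close>

text \<open>At a single \<open>x\<close> compactness of \<open>C\<close> gives a gap
  \<open>2 * e x\<close>. Half of it survives on the \<open>D\<close>-ball of radius
  \<open>e x\<close>, and finitely many such balls cover \<open>K\<close>.\<close>

lemma uniform_separation:
  fixes D :: "'a::metric_space \<Rightarrow> 'a \<Rightarrow> real"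
  assumes "compact K" "\<And>C. C \<in> F \<Longrightarrow> compact C"
    and cont: "continuous_on UNIV (\<lambda>(x, y). D x y)"
    and tri: "\<And>x y z. D x z \<le> D x y + D y z" and refl: "\<And>x. D x x = 0"
    and sep: "\<And>x. x \<in> K \<Longrightarrow> \<exists>C\<in>F. \<forall>y\<in>C. 0 < D x y"
  shows "\<exists>\<eta>>0. \<forall>x\<in>K. \<exists>C\<in>F. \<forall>y\<in>C. \<eta> \<le> D x y"
proof -
  have Dc: "continuous_on S (D x)" for S x
    using continuous_on_compose2[OF cont, of S "\<lambda>y. (x, y)"]
    by (simp add: continuous_on_Pair continuous_on_const continuous_on_id)
  have "\<exists>e>0. \<exists>C\<in>F. \<forall>y\<in>C. 2 * e \<le> D x y" if x: "x \<in> K" for x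
  proof -
    obtain C where C: "C \<in> F" "\<And>y. y \<in> C \<Longrightarrow> 0 < D x y"
      using sep[OF x] by blast
    show ?thesis
    proof (cases "C = {}")
      case True
      then show ?thesis using C(1) by (intro exI[of _ 1]) auto
    next
      case False
      then obtain y where "y \<in> C" "\<And>y'. y' \<in> C \<Longrightarrow> D x y \<le> D x y'"
        using continuous_attains_inf[OF assms(2)[OF C(1)] _ Dc] by blast
      then show ?thesis
        using C by (intro exI[of _ "D x y / 2"]) auto
    qed
  qed
  then obtain e where e: "\<And>x. x \<in> K \<Longrightarrow> 0 < e x \<and> (\<exists>C\<in>F. \<forall>y\<in>C. 2 * e x \<le> D x y)"
    by metis
  have balls_open: "open {y. D x y < e x}" for x
    using Dc[of UNIV x] by (intro open_Collect_less) auto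
  have "D x x < e x" if "x \<in> K" for x
    using e[OF that] refl by simp
  then have balls_cover: "K \<subseteq> (\<Union>x\<in>K. {y. D x y < e x})"
    by auto
  obtain X where X: "X \<subseteq> K" "finite X" "K \<subseteq> (\<Union>x\<in>X. {y. D x y < e x})"
    by (rule compactE_image[OF \<open>compact K\<close> balls_open balls_cover])
  define \<eta> where "\<eta> = Min (insert 1 (e ` X))"
  have "0 < \<eta>" "\<And>x. x \<in> X \<Longrightarrow> \<eta> \<le> e x"
    using X e by (auto simp: \<eta>_def)
  moreover have "\<exists>C\<in>F. \<forall>y\<in>C. \<eta> \<le> D x y" if "x \<in> K" for x
  proof -
    obtain x' where x': "x' \<in> X" "D x' x < e x'"
      using X(3) \<open>x \<in> K\<close> by blast
    then obtain C where C: "C \<in> F" "\<And>y. y \<in> C \<Longrightarrow> 2 * e x' \<le> D x' y"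
      using e X(1) by blast
    have "\<eta> \<le> D x y" if "y \<in> C" for y
      using C(2)[OF that] x' tri[of x' y x] \<open>\<And>x. x \<in> X \<Longrightarrow> \<eta> \<le> e x\<close>[OF x'(1)] by linarith
    with C(1) show ?thesis by blast
  qed
  ultimately show ?thesis by blast
qed

text \<open>From here on, continuity of a map into the complex is used only coordinatewise.\<close>

lemma continuous_map_coordinate:
  "continuous_map (realization_topology Y) euclideanreal (\<lambda>y. y v)"
  unfolding continuous_map_def
proof (intro conjI allI impI)
  fix U :: "real set" assume "openin euclideanreal U"
  then have "open {y::'a \<Rightarrow> real. y v \<in> U}"
    using open_vimage[of U "\<lambda>y. y v"] continuous_on_product_coordinates by (auto simp: vimage_def)
  moreover have "{y \<in> realization Y. y v \<in> U} \<inter> geometric_simplex \<sigma> = geometric_simplex \<sigma> \<inter> {y. y v \<in> U}"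
    if "\<sigma> \<in> Y" for \<sigma>
    using that by (auto simp: realization_def)
  ultimately have "openin (realization_topology Y) {y \<in> realization Y. y v \<in> U}"
    unfolding openin_realization_topology by (auto intro: openin_open_Int)
  then show "openin (realization_topology Y) {y \<in> topspace (realization_topology Y). y v \<in> U}"
    by (simp add: topspace_realization_topology)
qed auto

lemma realizationE:
  assumes "y \<in> realization Y" "abstract_complex Y"
  obtains \<sigma> where "\<sigma> \<in> Y" "finite \<sigma>" "\<And>v. 0 \<le> y v" "{v. y v \<noteq> 0} \<subseteq> \<sigma>" "(\<Sum>v\<in>\<sigma>. y v) = 1"
proof -
  obtain \<sigma> where \<sigma>: "\<sigma> \<in> Y" "y \<in> geometric_simplex \<sigma>"
    using assms(1) by (auto simp: realization_def)
  show thesis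
  proof (rule that[OF \<sigma>(1)])
    show "finite \<sigma>"
      using assms(2) \<sigma>(1) unfolding abstract_complex_def by blast
  qed (use \<sigma>(2) in \<open>auto simp: geometric_simplex_def\<close>)
qed

text \<open>Finitely many preimages of open vertex stars cover \<open>K\<close>. Every vertex in the
  support of \<open>f x\<close> shares a simplex with one of these star centres, and local
  finiteness leaves finitely many such vertices.\<close>

lemma compact_finite_vertices:
  assumes "compact K" and Y: "abstract_complex Y" "locally_finite_complex Y"
    and f: "\<And>x. f x \<in> realization Y" "\<And>v. continuous_on UNIV (\<lambda>x. f x v)"
  shows "\<exists>V. finite V \<and> (\<forall>x\<in>K. \<forall>v. f x v \<noteq> 0 \<longrightarrow> v \<in> V)"
proof -
  have stars_open: "open {x. 0 < f x v}" for v
    using f(2) by (intro open_Collect_less) auto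
  have pos: "\<exists>v\<in>\<Union>Y. 0 < f x v" for x
  proof -
    obtain \<sigma> where \<sigma>: "\<sigma> \<in> Y" "(\<Sum>v\<in>\<sigma>. f x v) = 1" "\<And>v. 0 \<le> f x v"
      using realizationE[OF f(1)[of x] Y(1)] by metis
    then obtain v where "v \<in> \<sigma>" "f x v \<noteq> 0"
      by (metis sum.neutral zero_neq_one)
    with \<sigma>(1) \<sigma>(3)[of v] show ?thesis
      by (intro bexI[of _ v]) auto
  qed
  have stars_cover: "K \<subseteq> (\<Union>v\<in>\<Union>Y. {x. 0 < f x v})"
    by (rule subsetI) (simp only: UN_iff mem_Collect_eq pos)
  obtain W where W: "W \<subseteq> \<Union>Y" "finite W" "K \<subseteq> (\<Union>v\<in>W. {x. 0 < f x v})"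
    by (rule compactE_image[OF \<open>compact K\<close> stars_open stars_cover])
  define V where "V = (\<Union>w\<in>W. \<Union>{\<sigma> \<in> Y. w \<in> \<sigma>})"
  have "finite (\<Union>{\<sigma> \<in> Y. w \<in> \<sigma>})" if "w \<in> W" for w
  proof (rule finite_Union)
    show "finite {\<sigma> \<in> Y. w \<in> \<sigma>}"
      using Y(2) W(1) that unfolding locally_finite_complex_def by blast
    show "finite \<sigma>" if "\<sigma> \<in> {\<sigma> \<in> Y. w \<in> \<sigma>}" for \<sigma>
      using Y(1) that unfolding abstract_complex_def by blast
  qed
  then have "finite V"
    using W(2) by (auto simp: V_def)
  moreover have "v \<in> V" if x: "x \<in> K" and v: "f x v \<noteq> 0" for x v
  proof -
    obtain w where w: "w \<in> W" "0 < f x w" using W(3) x by blast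
    obtain \<sigma> where "\<sigma> \<in> Y" "{v. f x v \<noteq> 0} \<subseteq> \<sigma>"
      using realizationE[OF f(1)[of x] Y(1)] by metis
    with w v have "v \<in> \<sigma>" "w \<in> \<sigma>" by auto
    with w(1) \<open>\<sigma> \<in> Y\<close> show ?thesis unfolding V_def by blast
  qed
  ultimately show ?thesis by blast
qed

text \<open>
  The labels come from the cover of \<open>K\<close> by the preimages of the open stars of an edgewise
  subdivision of the simplices: with \<open>S x i\<close> the partial sums of the barycentric coordinates of
  \<open>f x\<close> and \<open>N\<close> large, \<open>W z\<close> is the star of the lattice point \<open>z\<close> in the coordinates
  \<open>N * S x i\<close>. At most \<open>d + 1\<close> coordinates of \<open>f x\<close> are nonzero, so at most \<open>d + 1\<close> stars
  contain \<open>x\<close>.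
\<close>

lemma separating_labels:
  fixes f :: "'a::euclidean_space \<Rightarrow> 'v \<Rightarrow> real" and F :: "'a set set"
  assumes "compact K" "\<And>C. C \<in> F \<Longrightarrow> compact C"
    and Y: "abstract_complex Y" "locally_finite_complex Y" "has_complex_dim Y d"
    and f: "\<And>x. f x \<in> realization Y" "\<And>v. continuous_on UNIV (\<lambda>x. f x v)"
    and sep: "\<And>x. x \<in> K \<Longrightarrow> \<exists>C\<in>F. \<forall>y\<in>C. f y \<noteq> f x"
  obtains lab \<epsilon> where "0 < (\<epsilon>::real)" "\<And>x. x \<in> K \<Longrightarrow> lab x \<in> F \<and> x \<notin> lab x"
    and "\<And>s. small \<epsilon> s \<Longrightarrow> set s \<subseteq> K \<Longrightarrow> card (lab ` set s) \<le> d + 1"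
proof -
  \<comment> \<open>Only over \<open>K\<close> do finitely many coordinates determine
    \<open>f x\<close>, so the separation is measured to \<open>C \<inter> K\<close>.\<close>
  let ?F' = "(\<lambda>C. C \<inter> K) ` F"
  obtain V where V: "finite V" "\<And>x v. x \<in> K \<Longrightarrow> f x v \<noteq> 0 \<Longrightarrow> v \<in> V"
    using compact_finite_vertices[OF \<open>compact K\<close> Y(1,2) f] by blast
  define M where "M = card V"
  obtain e where e: "bij_betw e {..<M} V"
    using ex_bij_betw_nat_finite[OF V(1)] by (auto simp: M_def atLeast0LessThan)
  define S where "S x i = (\<Sum>k<i. f x (e k))" for x i
  have S_cont: "continuous_on UNIV (\<lambda>x. S x i)" for i
    unfolding S_def by (intro continuous_intros f(2))
  define D where "D x y = (\<Sum>i\<le>M. \<bar>S x i - S y i\<bar>)" for x y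
  have D_pos: "0 < D x y" if "x \<in> K" "y \<in> K" "f x \<noteq> f y" for x y
  proof -
    obtain v where v: "f x v \<noteq> f y v" using \<open>f x \<noteq> f y\<close> by blast
    then have "v \<in> V" using V(2) \<open>x \<in> K\<close> \<open>y \<in> K\<close> by metis
    then obtain k where k: "k < M" "v = e k" using e by (auto simp: bij_betw_def)
    have "S x k \<noteq> S y k \<or> S x (Suc k) \<noteq> S y (Suc k)"
      using v k by (auto simp: S_def)
    then obtain i where i: "i \<le> M" "S x i \<noteq> S y i"
      using k(1) by (meson Suc_leI less_imp_le_nat)
    then have "0 < \<bar>S x i - S y i\<bar>" by simp
    also have "\<dots> \<le> D x y"
      unfolding D_def using i(1) by (intro member_le_sum) auto
    finally show ?thesis .
  qed
  have "\<exists>\<eta>>0. \<forall>x\<in>K. \<exists>C\<in>?F'. \<forall>y\<in>C. \<eta> \<le> D x y"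
  proof (rule uniform_separation[OF \<open>compact K\<close>])
    show "compact C" if "C \<in> ?F'" for C
      using that assms(1,2) by (auto intro: compact_Int)
    show "continuous_on UNIV (\<lambda>(x, y). D x y)"
      unfolding D_def case_prod_unfold
      by (intro continuous_intros continuous_on_compose2[OF S_cont]) auto
    show "D x z \<le> D x y + D y z" for x y z
      unfolding D_def sum.distrib[symmetric] by (intro sum_mono) auto
    show "D x x = 0" for x
      by (simp add: D_def)
    show "\<exists>C\<in>?F'. \<forall>y\<in>C. 0 < D x y" if "x \<in> K" for x
    proof -
      obtain C where "C \<in> F" "\<And>y. y \<in> C \<Longrightarrow> f y \<noteq> f x"
        using sep[OF \<open>x \<in> K\<close>] by blast
      with D_pos[OF that] show ?thesis
        by (intro bexI[of _ "C \<inter> K"]) (auto simp: eq_commute[of "f x"])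
    qed
  qed
  then obtain \<eta> where \<eta>: "0 < \<eta>" "\<And>x. x \<in> K \<Longrightarrow> \<exists>C\<in>F. \<forall>y\<in>C \<inter> K. \<eta> \<le> D x y"
    by auto
  \<comment> \<open>Two points of one star will differ by at most \<open>2 / N\<close> in each of
    \<open>M + 1\<close> partial sums.\<close>
  obtain N :: nat where "2 * real (M + 1) / \<eta> < real N"
    using reals_Archimedean2 by blast
  moreover from this have "0 < real N"
    using \<eta>(1) by (smt (verit) divide_nonneg_pos of_nat_0_le_iff)
  ultimately have N: "real (M + 1) * (2 / real N) < \<eta>" "0 < N"
    using \<eta>(1) by (auto simp: field_simps)
  define Z where "Z = {z::nat \<Rightarrow> int. z 0 = 0 \<and> (\<forall>i>M. z i = 0)}"
  define W where "W z = {x. \<forall>i\<in>{..M}. \<forall>j\<in>{..M}.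
      (N * S x i - of_int (z i)) - (N * S x j - of_int (z j)) < 1}" for z :: "nat \<Rightarrow> int"
  have W_open: "open (W z)" for z
  proof -
    have "open {x. (N * S x i - of_int (z i)) - (N * S x j - of_int (z j)) < 1}" for i j
      by (intro open_Collect_less continuous_intros S_cont)
    moreover have "W z = (\<Inter>i\<in>{..M}. \<Inter>j\<in>{..M}.
        {x. (N * S x i - of_int (z i)) - (N * S x j - of_int (z j)) < 1})"
      by (auto simp: W_def)
    ultimately show ?thesis by (simp add: open_INT)
  qed
  have S0: "S x 0 = 0" for x by (simp add: S_def)
  have W_cover: "\<exists>z\<in>Z. x \<in> W z" for x
  proof
    let ?z = "\<lambda>i. if i \<le> M then \<lfloor>N * S x i\<rfloor> else 0"
    show "?z \<in> Z" by (simp add: Z_def S0)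
    have "N * S x i - of_int \<lfloor>N * S x i\<rfloor> - (N * S x j - of_int \<lfloor>N * S x j\<rfloor>) < 1" for i j
      by linarith
    then show "x \<in> W ?z" by (simp add: W_def)
  qed
  have W_thin: "D x y < \<eta>" if z: "z \<in> Z" and xy: "x \<in> W z" "y \<in> W z" for x y z
  proof -
    have "\<bar>S x i - S y i\<bar> \<le> 2 / N" if "i \<le> M" for i
    proof -
      have "\<bar>N * S w i - of_int (z i)\<bar> < 1" if "w \<in> W z" for w
      proof -
        have "N * S w i - of_int (z i) - (N * S w 0 - of_int (z 0)) < 1"
          "N * S w 0 - of_int (z 0) - (N * S w i - of_int (z i)) < 1"
          using that \<open>i \<le> M\<close> by (auto simp: W_def)
        then show ?thesis using z by (simp add: S0 Z_def)
      qed
      from this[OF xy(1)] this[OF xy(2)] have "\<bar>N * S x i - N * S y i\<bar> \<le> 2"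
        by linarith
      then have "N * \<bar>S x i - S y i\<bar> \<le> 2"
        by (simp add: abs_mult flip: right_diff_distrib)
      then show ?thesis using N(2) by (simp add: field_simps)
    qed
    then have "D x y \<le> (\<Sum>i\<le>M. 2 / N)"
      unfolding D_def by (intro sum_mono) auto
    with N(1) show ?thesis by (simp add: algebra_simps)
  qed
  have W_order: "finite {z\<in>Z. x \<in> W z} \<and> card {z\<in>Z. x \<in> W z} \<le> d + 1" if x: "x \<in> K" for x
  proof -
    obtain \<sigma> where \<sigma>: "\<sigma> \<in> Y" "finite \<sigma>" "{v. f x v \<noteq> 0} \<subseteq> \<sigma>" "(\<Sum>v\<in>\<sigma>. f x v) = 1"
      using realizationE[OF f(1)[of x] Y(1)] by metis
    define b where "b i = N * f x (e i)" for i
    have b: "(\<Sum>k<i. b k) = N * S x i" for i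
      by (simp add: b_def S_def sum_distrib_left)
    have "S x M = (\<Sum>v\<in>V. f x v)"
      unfolding S_def using sum.reindex_bij_betw[OF e] by blast
    also have "\<dots> = (\<Sum>v\<in>\<sigma>. f x v)"
      using \<sigma> V x by (intro sum.mono_neutral_cong) auto
    finally have "(\<Sum>k<M. b k) = of_nat N"
      using \<sigma>(4) by (simp add: b)
    from card_frac_partial_sums[OF this N(2)]
    have "card ((\<lambda>i. frac (N * S x i)) ` {..M}) \<le> card {i. i < M \<and> b i \<noteq> 0}"
      by (simp add: b)
    also have "\<dots> \<le> card \<sigma>"
    proof (rule card_inj_on_le[OF _ _ \<sigma>(2)])
      show "inj_on e {i. i < M \<and> b i \<noteq> 0}"
        using e by (auto simp: bij_betw_def inj_on_def)
      show "e ` {i. i < M \<and> b i \<noteq> 0} \<subseteq> \<sigma>"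
        using \<sigma>(3) by (auto simp: b_def)
    qed
    also have "\<dots> \<le> d + 1"
      using Y(3) \<sigma>(1) by (simp add: has_complex_dim_def)
    finally have "card ((\<lambda>i. frac (N * S x i)) ` {..M}) \<le> d + 1" .
    moreover have "{z\<in>Z. x \<in> W z} = {z. z 0 = 0 \<and> (\<forall>i>M. z i = 0) \<and>
        (\<forall>i\<le>M. \<forall>j\<le>M. N * S x i - of_int (z i) - (N * S x j - of_int (z j)) < 1)}"
      by (auto simp: Z_def W_def)
    ultimately show ?thesis
      using card_lattice_le[of "\<lambda>i. N * S x i" M] by (auto simp: S0)
  qed
  \<comment> \<open>A star is thinner than \<open>\<eta>\<close>, so within \<open>K\<close> it
    misses the member separated from one of its points.\<close>
  have "\<exists>C\<in>F. W z \<inter> K \<inter> C = {}" if "z \<in> Z" "W z \<inter> K \<noteq> {}" for z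
  proof -
    obtain x where x: "x \<in> W z" "x \<in> K" using \<open>W z \<inter> K \<noteq> {}\<close> by blast
    obtain C where "C \<in> F" "\<And>y. y \<in> C \<inter> K \<Longrightarrow> \<eta> \<le> D x y"
      using \<eta>(2)[OF x(2)] by blast
    then show ?thesis
      using W_thin[OF \<open>z \<in> Z\<close> x(1)] by (metis IntE IntI disjoint_iff linorder_not_le)
  qed
  then obtain \<iota> where \<iota>: "\<And>z. z \<in> Z \<Longrightarrow> W z \<inter> K \<noteq> {} \<Longrightarrow> \<iota> z \<in> F \<and> W z \<inter> K \<inter> \<iota> z = {}"
    by metis
  have "K \<subseteq> \<Union>(W ` Z)" using W_cover by blast
  then obtain \<epsilon> where \<epsilon>: "0 < \<epsilon>" "\<And>x. x \<in> K \<Longrightarrow> \<exists>G\<in>W ` Z. ball x \<epsilon> \<subseteq> G"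
    using Heine_Borel_lemma[OF \<open>compact K\<close>] W_open by (metis imageE)
  then have "\<forall>x\<in>K. \<exists>z. z \<in> Z \<and> ball x \<epsilon> \<subseteq> W z"
    by (simp add: image_iff Bex_def) blast
  from bchoice[OF this] obtain \<zeta> where
    \<zeta>: "\<And>x. x \<in> K \<Longrightarrow> \<zeta> x \<in> Z \<and> ball x \<epsilon> \<subseteq> W (\<zeta> x)"
    by blast
  show thesis
  proof (rule that[of \<epsilon> "\<iota> \<circ> \<zeta>"])
    show "0 < \<epsilon>" by fact
    show "(\<iota> \<circ> \<zeta>) x \<in> F \<and> x \<notin> (\<iota> \<circ> \<zeta>) x" if x: "x \<in> K" for x
    proof -
      have "x \<in> W (\<zeta> x) \<inter> K"
        using \<zeta>[OF x] x \<epsilon>(1) by auto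
      then show ?thesis
        using \<iota>[of "\<zeta> x"] \<zeta>[OF x] by auto
    qed
    show "card ((\<iota> \<circ> \<zeta>) ` set s) \<le> d + 1" if s: "small \<epsilon> s" "set s \<subseteq> K" for s
    proof (cases s)
      case (Cons q t)
      then have q: "q \<in> set s" by simp
      then have "q \<in> K" using s(2) by blast
      \<comment> \<open>The stars chosen for the points of \<open>s\<close> all contain
        \<open>q\<close>, which lies in at most \<open>d + 1\<close> stars.\<close>
      have "\<zeta> x \<in> {z\<in>Z. q \<in> W z}" if x: "x \<in> set s" for x
      proof -
        have "q \<in> ball x \<epsilon>"
          using s(1) x q by (simp add: small_def)
        moreover have "x \<in> K" using x s(2) by blast
        ultimately show ?thesis using \<zeta> by blast
      qed
      then have "card (\<zeta> ` set s) \<le> card {z\<in>Z. q \<in> W z}"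
        using W_order[OF \<open>q \<in> K\<close>] by (intro card_mono image_subsetI) blast+
      moreover have "card ((\<iota> \<circ> \<zeta>) ` set s) \<le> card (\<zeta> ` set s)"
        unfolding image_comp[symmetric] by (intro card_image_le) simp
      ultimately show ?thesis
        using W_order[OF \<open>q \<in> K\<close>] by linarith
    qed simp
  qed
qed

theorem corollary2:
  fixes d :: nat
    and F :: "(real ^ 'm) set set"
    and Y :: "'v set set"
    and f :: "real ^ 'm \<Rightarrow> 'v \<Rightarrow> real"
  assumes "CARD('m) > d" and "d \<ge> 1"
    and "finite F"
    and "\<And>C. C \<in> F \<Longrightarrow> compact C \<and> convex C"
    and "abstract_complex Y" and "locally_finite_complex Y" and "has_complex_dim Y d"
    and "\<And>G. G \<subseteq> F \<Longrightarrow> card G \<le> d + 1 \<Longrightarrow> \<Inter>G \<noteq> {}"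
    and "continuous_map euclidean (realization_topology Y) f"
  shows "\<exists>y\<in>realization Y. \<forall>C\<in>F. f -` {y} \<inter> C \<noteq> {}"
proof (rule ccontr)
  assume contra: "\<not> ?thesis"
  have fY: "f x \<in> realization Y" for x
    using continuous_map_image_subset_topspace[OF assms(9)]
    by (auto simp: topspace_realization_topology)
  have f_cont: "continuous_on UNIV (\<lambda>x. f x v)" for v
    using continuous_map_compose[OF assms(9) continuous_map_coordinate[of Y v]] by (simp add: o_def)
  have sep: "\<exists>C\<in>F. \<forall>y\<in>C. f y \<noteq> f x" for x
  proof -
    obtain C where "C \<in> F" "f -` {f x} \<inter> C = {}"
      using contra fY[of x] by metis
    then show ?thesis
      by (intro bexI[of _ C]) auto
  qed
  define p where "p S = (SOME x. x \<in> \<Inter>S)" for S :: "(real ^ 'm) set set"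
  have p: "p S \<in> \<Inter>S" if "S \<subseteq> F" "card S \<le> d + 1" for S
    unfolding p_def using assms(8)[OF that] by (rule some_in_eq[THEN iffD2])
  \<comment> \<open>Subfamilies with empty intersection contribute arbitrary points, but the hull is
    still that of finitely many points.\<close>
  define K where "K = convex hull (p ` Pow F)"
  have K: "compact K" "convex K"
    using \<open>finite F\<close> by (auto simp: K_def intro: finite_imp_compact_convex_hull)
  have pK: "p S \<in> K \<inter> \<Inter>S" if "S \<subseteq> F" "card S \<le> d + 1" for S
    using p[OF that] that(1) by (auto simp: K_def intro: hull_inc)
  have compact: "\<And>C. C \<in> F \<Longrightarrow> compact C" and convex: "\<And>C. C \<in> F \<Longrightarrow> convex C"
    using assms(4) by blast+
  show False
  proof (rule separating_labels[OF K(1) compact assms(5-7) fY f_cont sep])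
    fix lab \<epsilon>
    assume "0 < (\<epsilon>::real)" "\<And>x. x \<in> K \<Longrightarrow> lab x \<in> F \<and> x \<notin> lab x"
      "\<And>s. small \<epsilon> s \<Longrightarrow> set s \<subseteq> K \<Longrightarrow> card (lab ` set s) \<le> d + 1"
    then show False
      by (intro few_labels_contradiction[where lab = lab and \<epsilon> = \<epsilon> and d = d,
            OF K(2) \<open>finite F\<close> convex pK])
  qed
qed

end
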